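(* Let $\gamma\in\mathbb{C}$ with $0<|\gamma|<1$ be fixed. The following asymptotic formulas hold: $$\lambda_{\gamma,n,j}=2i-\frac{i\pi^2j^2}{(n+1)^2}+\frac{2\gamma}{1+i\gamma}\,\frac{\pi^2j^2}{(n+1)^3}+O\left(\frac{j^4}{n^4}\right)\qquad\left(\frac{j}{n}\to 0\right),$$ $$\lambda_{\gamma,n,j}=-2i+i\pi^2\left(1-\frac{j}{n+1}\right)^2+\frac{2\gamma\pi^2}{1-i\gamma}\,\frac{\left(1-\frac{j}{n+1}\right)^2}{n+1}+O\left(\left(1-\frac{j}{n+1}\right)^4\right)\qquad\left(\frac{j}{n}\to 1\right).$$
   Context: $A_{\gamma,n}$ is the $n\times n$ matrix $T_n(a)+\gamma E_{n,1,1}$, where $T_n(a)$ is the tridiagonal Toeplitz matrix with entries $(T_n(a))_{j+1,j}=1$, $(T_n(a))_{j,j+1}=-1$ and all other entries $0$, and $E_{n,1,1}$ has entry $(1,1)$ equal to $1$ and all other entries $0$. $\psi(z)=2i\cos(z)$. $\Delta_\gamma=\ln\frac{1}{|\gamma|}$. For $|\operatorname{Im}(z)|<\Delta_\gamma$, $$\vartheta_\gamma(z)=-\frac{i}{2}\ln\left(\frac{1+i\gamma e^{iz}}{1+i\gamma e^{-iz}}\right),$$ where $\ln$ is the principal branch of the logarithm on $\mathbb{C}\setminus(-\infty,0]$ (the argument of the logarithm lies in this set for all such $z$). Definition of $\lambda_{\gamma,n,j}$: put $d_{n,j}=\frac{j\pi}{n+1}$, $p_{\gamma,n,j}=d_{n,j}+\frac{\vartheta_\gamma(d_{n,j})}{n+1}$,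 $M_\gamma=\frac{64\sqrt{|\gamma|}}{(1-|\gamma|)^3}$, $N_\gamma=\frac{16}{(1-|\gamma|)^2}$, and $\mathcal{B}_{\gamma,n,j}=\{z\in\mathbb{C}\colon |z-p_{\gamma,n,j}|<M_\gamma/(n+1)^2\}$. For every integer $n\ge N_\gamma$ and $j\in\{1,\ldots,n\}$, there is a unique $s_{\gamma,n,j}\in\mathcal{B}_{\gamma,n,j}$ with $s_{\gamma,n,j}=\frac{j\pi}{n+1}+\frac{\vartheta_\gamma(s_{\gamma,n,j})}{n+1}$; define $\lambda_{\gamma,n,j}=\psi(s_{\gamma,n,j})$. The numbers $\lambda_{\gamma,n,1},\ldots,\lambda_{\gamma,n,n}$ are pairwise distinct and are the eigenvalues of $A_{\gamma,n}$. Meaning of the asymptotic notation: "$X_{n,j}=Y_{n,j}+O(Z_{n,j})$ as $j/n\to c$" means that there exist constants $C>0$ and $\varepsilon>0$ (depending only on $\gamma$) such that $|X_{n,j}-Y_{n,j}|\le C\,Z_{n,j}$ for all integers $n\ge N_\gamma$ and $j\in\{1,\ldots,n\}$ with $|j/n-c|<\varepsilon$. *)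

theory Defs
  imports "HOL-Analysis.Analysis"
begin

definition psi :: "complex \<Rightarrow> complex" where
  "psi z = 2 * \<i> * cos z"

(* Meant for \<bar>Im z\<bar> < ln (1 / norm \<gamma>): there the argument of Ln avoids the
   half-line (-\<infinity>, 0]. Outside that strip the value carries no meaning. *)
definition vartheta :: "complex \<Rightarrow> complex \<Rightarrow> complex" where
  "vartheta \<gamma> z =
     - (\<i> / 2) * Ln ((1 + \<i> * \<gamma> * exp (\<i> * z)) / (1 + \<i> * \<gamma> * exp (- \<i> * z)))"

definition d_pt :: "nat \<Rightarrow> nat \<Rightarrow> real" where
  "d_pt n j = real j * pi / (real n + 1)"

definition p_pt :: "complex \<Rightarrow> nat \<Rightarrow> nat \<Rightarrow> complex" where
  "p_pt \<gamma> n j = of_real (d_pt n j) + vartheta \<gamma> (of_real (d_pt n j)) / (of_nat n + 1)"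

definition M_const :: "complex \<Rightarrow> real" where
  "M_const \<gamma> = 64 * sqrt (norm \<gamma>) / (1 - norm \<gamma>) ^ 3"

definition N_const :: "complex \<Rightarrow> real" where
  "N_const \<gamma> = 16 / (1 - norm \<gamma>)\<^sup>2"

definition B_disk :: "complex \<Rightarrow> nat \<Rightarrow> nat \<Rightarrow> complex set" where
  "B_disk \<gamma> n j = ball (p_pt \<gamma> n j) (M_const \<gamma> / (real n + 1)\<^sup>2)"

(* For 0 < norm \<gamma> < 1, n \<ge> N_const \<gamma> and 1 \<le> j \<le> n the disk lies in the strip
   \<bar>Im z\<bar> < ln (1 / norm \<gamma>) and the map z \<mapsto> d + vartheta \<gamma> z / (n + 1) is a contraction
   there, so the definite description denotes. Other arguments are irrelevant. *)
definition s_pt :: "complex \<Rightarrow> nat \<Rightarrow> nat \<Rightarrow> complex" where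
  "s_pt \<gamma> n j = (THE s. s \<in> B_disk \<gamma> n j \<and>
     s = of_real (real j * pi / (real n + 1)) + vartheta \<gamma> s / (of_nat n + 1))"

(* For n \<ge> N_const \<gamma>, the values at j = 1, ..., n are the eigenvalues of the n-by-n
   tridiagonal matrix with 1 on the subdiagonal, -1 on the superdiagonal, and \<gamma> at (1,1)
   as its only nonzero diagonal entry. *)
definition lam :: "complex \<Rightarrow> nat \<Rightarrow> nat \<Rightarrow> complex" where
  "lam \<gamma> n j = psi (s_pt \<gamma> n j)"

(* X n j = Y n j + O(Z n j) as j/n tends to c, for the index range n \<ge> N, 1 \<le> j \<le> n;
   the bound is uniform in n and j. *)
definition expansion_near ::
  "real \<Rightarrow> real \<Rightarrow> (nat \<Rightarrow> nat \<Rightarrow> complex) \<Rightarrow> (nat \<Rightarrow> nat \<Rightarrow> complex) \<Rightarrow> (nat \<Rightarrow> nat \<Rightarrow> real) \<Rightarrow> bool"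
where
  "expansion_near N c X Y Z \<longleftrightarrow>
     (\<exists>C>0. \<exists>\<epsilon>>0. \<forall>n j. real n \<ge> N \<and> j \<in> {1..n} \<and> \<bar>real j / real n - c\<bar> < \<epsilon> \<longrightarrow>
        norm (X n j - Y n j) \<le> C * Z n j)"

end

theory Submission
  imports Defs
begin

text \<open>
  The eigenvalue \<open>lam \<gamma> n j\<close> is \<open>2 \<i> cos s\<close>, where \<open>s = d + \<theta>(s) / (n + 1)\<close> with
  \<open>d = j \<pi> / (n + 1)\<close> and \<open>\<theta> = vartheta \<gamma>\<close>. Near the left end of the spectrum everything
  is governed by the Taylor expansion of \<open>\<theta>\<close> at its zero \<open>0\<close>. With \<open>m = n + 1\<close> and
  \<open>a = \<theta>'(0) = \<i> \<gamma> / (1 + \<i> \<gamma>)\<close>, the equation gives \<open>s = d + a s / m + O(s\<^sup>2 / m)\<close>. The key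
  observation is that \<open>j \<ge> 1\<close> forces \<open>1 / m \<le> d\<close>, so each factor \<open>1 / m\<close> may be traded for a
  factor \<open>d\<close>. Hence \<open>s\<^sup>2 = d\<^sup>2 (1 + 2 a / m) + O(d\<^sup>4)\<close>, and inserting this into
  \<open>2 cos s = 2 - s\<^sup>2 + O(s\<^sup>4)\<close> yields the first formula (\<open>cos_fixed_point_expansion\<close>).

  The right end reduces to the left one by a symmetry: \<open>vartheta \<gamma> (\<pi> - t) = - vartheta (- \<gamma>) t\<close>
  (\<open>vartheta_pi_minus\<close>), so \<open>t = \<pi> - s\<close> solves the same fixed point equation with \<open>- \<gamma>\<close> in place
  of \<open>\<gamma>\<close> and \<open>\<pi> - d\<close> in place of \<open>d\<close>, while \<open>cos\<close> only changes sign.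

  All analytic input consists of bounds for \<open>\<theta>'\<close> and \<open>\<theta>''\<close> on a closed horizontal strip of
  half-width \<open>b\<close> with \<open>\<bar>\<gamma>\<bar> exp b < 1\<close>, strictly inside the strip where \<open>\<theta>\<close> is holomorphic. The
  same bounds show that the fixed point map is a contraction of the disk used in the
  definition of \<open>s_pt\<close>, so that the definite description denotes (\<open>s_pt_fixed_point\<close>).
\<close>

section \<open>Derivative bounds for the phase function in a strip\<close>

definition strip :: "real \<Rightarrow> complex set" where
  "strip b = {z. \<bar>Im z\<bar> \<le> b}"

lemma convex_strip: "convex (strip b)"
proof -
  have "strip b = {z. Im z \<le> b} \<inter> {z. Im z \<ge> - b}"
    by (auto simp: strip_def)
  thus ?thesis
    by (simp add: convex_Int convex_halfspace_Im_le convex_halfspace_Im_ge)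
qed

lemma pi_minus_mem_strip: "z \<in> strip b \<Longrightarrow> of_real pi - z \<in> strip b"
  by (simp add: strip_def)

text \<open>
  The two exponential terms in \<open>vartheta\<close> are \<open>wave \<gamma> z\<close> and \<open>wave \<gamma> (- z)\<close>. In the strip, both are
  bounded by \<open>norm \<gamma> * exp b\<close>, and the bounds on \<open>vartheta\<close> and its derivatives are functions of
  this number alone.
\<close>

definition wave :: "complex \<Rightarrow> complex \<Rightarrow> complex" where
  "wave \<gamma> z = \<i> * \<gamma> * exp (\<i> * z)"

lemma norm_wave_le:
  assumes "z \<in> strip b"
  shows "norm (wave \<gamma> z) \<le> norm \<gamma> * exp b"
  using assms by (auto simp: wave_def strip_def norm_mult intro!: mult_left_mono)

lemma norm_wave_neg_le:
  assumes "z \<in> strip b"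
  shows "norm (wave \<gamma> (- z)) \<le> norm \<gamma> * exp b"
  using assms by (auto simp: wave_def strip_def norm_mult intro!: mult_left_mono)

lemma wave_deriv [derivative_intros]:
  "(wave \<gamma> has_field_derivative (\<i> * wave \<gamma> z)) (at z within A)"
  unfolding wave_def by (auto intro!: derivative_eq_intros)

lemma wave_neg_deriv [derivative_intros]:
  "((\<lambda>z. wave \<gamma> (- z)) has_field_derivative (- \<i> * wave \<gamma> (- z))) (at z within A)"
  unfolding wave_def by (auto intro!: derivative_eq_intros)

lemma norm_one_plus_ge:
  fixes u :: complex
  assumes "norm u \<le> q"
  shows "1 - q \<le> norm (1 + u)"
  using norm_triangle_ineq2[of 1 "- u"] assms by simp

lemma norm_frac_le:
  fixes u :: complex
  assumes "norm u \<le> q" "q < 1"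
  shows "norm (u / (1 + u) ^ k) \<le> q / (1 - q) ^ k"
  unfolding norm_divide norm_power
  using assms norm_one_plus_ge[OF assms(1)]
  by (intro frac_le power_mono) (auto intro: order_trans[OF norm_ge_zero])

lemma Re_one_plus_pos:
  fixes u :: complex
  assumes "norm u < 1"
  shows "0 < Re (1 + u)"
  using abs_Re_le_cmod[of u] assms by simp

lemma one_plus_not_nonpos_Reals:
  fixes u :: complex
  assumes "norm u < 1"
  shows "1 + u \<notin> \<real>\<^sub>\<le>\<^sub>0"
  using Re_one_plus_pos[OF assms] by (auto simp: complex_nonpos_Reals_iff)

text \<open>
  In the strip, numerator and denominator lie in the right half-plane. Their logarithms
  therefore have imaginary parts below \<open>\<pi> / 2\<close>, and the difference of the logarithms is still
  in the principal range.
\<close>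

lemma vartheta_eq_Ln_diff:
  assumes "norm \<gamma> * exp b < 1" "z \<in> strip b"
  shows "vartheta \<gamma> z = - (\<i> / 2) * (Ln (1 + wave \<gamma> z) - Ln (1 + wave \<gamma> (- z)))"
proof -
  have u: "norm (wave \<gamma> z) < 1" and v: "norm (wave \<gamma> (- z)) < 1"
    using norm_wave_le[OF assms(2), of \<gamma>] norm_wave_neg_le[OF assms(2), of \<gamma>] assms(1) by auto
  have nz: "1 + wave \<gamma> z \<noteq> 0" "1 + wave \<gamma> (- z) \<noteq> 0"
    using Re_one_plus_pos[OF u] Re_one_plus_pos[OF v] by (auto simp: complex_eq_iff)
  have "\<bar>Im (Ln (1 + wave \<gamma> z))\<bar> < pi / 2" "\<bar>Im (Ln (1 + wave \<gamma> (- z)))\<bar> < pi / 2"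
    using Re_one_plus_pos[OF u] Re_one_plus_pos[OF v] by (blast intro: Re_Ln_pos_lt_imp)+
  hence "Ln ((1 + wave \<gamma> z) / (1 + wave \<gamma> (- z))) = Ln (1 + wave \<gamma> z) - Ln (1 + wave \<gamma> (- z))"
    using nz by (intro Ln_unique) (auto simp: exp_diff)
  thus ?thesis
    by (simp add: vartheta_def wave_def)
qed

text \<open>\<open>vartheta1\<close> and \<open>vartheta2\<close> are the first two derivatives of \<open>vartheta\<close> in the strip.\<close>

definition vartheta1 :: "complex \<Rightarrow> complex \<Rightarrow> complex" where
  "vartheta1 \<gamma> z =
     (wave \<gamma> z / (1 + wave \<gamma> z) + wave \<gamma> (- z) / (1 + wave \<gamma> (- z))) / 2"

definition vartheta2 :: "complex \<Rightarrow> complex \<Rightarrow> complex" where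
  "vartheta2 \<gamma> z =
     (\<i> / 2) * (wave \<gamma> z / (1 + wave \<gamma> z)\<^sup>2 - wave \<gamma> (- z) / (1 + wave \<gamma> (- z))\<^sup>2)"

lemma vartheta_deriv:
  assumes "norm \<gamma> * exp b < 1" "z \<in> strip b"
  shows "(vartheta \<gamma> has_field_derivative vartheta1 \<gamma> z) (at z within strip b)"
proof -
  have u: "norm (wave \<gamma> z) < 1" and v: "norm (wave \<gamma> (- z)) < 1"
    using norm_wave_le[OF assms(2), of \<gamma>] norm_wave_neg_le[OF assms(2), of \<gamma>] assms(1) by auto
  have "((\<lambda>z. - (\<i> / 2) * (Ln (1 + wave \<gamma> z) - Ln (1 + wave \<gamma> (- z))))
      has_field_derivative vartheta1 \<gamma> z) (at z within strip b)"
    using one_plus_not_nonpos_Reals[OF u] one_plus_not_nonpos_Reals[OF v]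
    by (auto intro!: derivative_eq_intros simp: vartheta1_def field_simps)
  thus ?thesis
    by (rule has_field_derivative_transform_within[OF _ zero_less_one assms(2)])
       (simp add: vartheta_eq_Ln_diff[OF assms(1)])
qed

lemma frac_one_plus_deriv:
  fixes f :: "complex \<Rightarrow> complex"
  assumes "(f has_field_derivative f') (at z within A)" "1 + f z \<noteq> 0"
  shows "((\<lambda>z. f z / (1 + f z)) has_field_derivative f' / (1 + f z)\<^sup>2) (at z within A)"
  using assms(2)
  by (auto intro!: derivative_eq_intros assms(1) simp: algebra_simps power2_eq_square)

lemma vartheta1_deriv:
  assumes "norm \<gamma> * exp b < 1" "z \<in> strip b"
  shows "(vartheta1 \<gamma> has_field_derivative vartheta2 \<gamma> z) (at z within strip b)"
proof -
  have u: "norm (wave \<gamma> z) < 1" and v: "norm (wave \<gamma> (- z)) < 1"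
    using norm_wave_le[OF assms(2), of \<gamma>] norm_wave_neg_le[OF assms(2), of \<gamma>] assms(1) by auto
  have nz: "1 + wave \<gamma> z \<noteq> 0" "1 + wave \<gamma> (- z) \<noteq> 0"
    using Re_one_plus_pos[OF u] Re_one_plus_pos[OF v] by (auto simp: complex_eq_iff)
  have "(vartheta1 \<gamma> has_field_derivative
      (\<i> * wave \<gamma> z / (1 + wave \<gamma> z)\<^sup>2 + - \<i> * wave \<gamma> (- z) / (1 + wave \<gamma> (- z))\<^sup>2) / 2)
      (at z within strip b)"
    unfolding vartheta1_def[abs_def]
    by (intro DERIV_cdivide DERIV_add frac_one_plus_deriv wave_deriv wave_neg_deriv nz)
  thus ?thesis
    by (simp add: vartheta2_def right_diff_distrib diff_divide_distrib mult.commute)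
qed

lemma average_le: "x \<le> c \<Longrightarrow> y \<le> c \<Longrightarrow> (x + y) / 2 \<le> c" for x y c :: real
  by simp

lemma norm_vartheta1_le:
  assumes "norm \<gamma> * exp b < 1" "z \<in> strip b"
  shows "norm (vartheta1 \<gamma> z) \<le> norm \<gamma> * exp b / (1 - norm \<gamma> * exp b)"
proof -
  have "norm (vartheta1 \<gamma> z)
    \<le> (norm (wave \<gamma> z / (1 + wave \<gamma> z)) + norm (wave \<gamma> (- z) / (1 + wave \<gamma> (- z)))) / 2"
    unfolding vartheta1_def norm_divide[of _ 2] using norm_triangle_ineq by (simp del: norm_divide)
  also have "\<dots> \<le> norm \<gamma> * exp b / (1 - norm \<gamma> * exp b)"
    using norm_frac_le[OF norm_wave_le[OF assms(2)] assms(1), of 1]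
      norm_frac_le[OF norm_wave_neg_le[OF assms(2)] assms(1), of 1]
    unfolding power_one_right by (rule average_le)
  finally show ?thesis .
qed

lemma norm_vartheta2_le:
  assumes "norm \<gamma> * exp b < 1" "z \<in> strip b"
  shows "norm (vartheta2 \<gamma> z) \<le> norm \<gamma> * exp b / (1 - norm \<gamma> * exp b)\<^sup>2"
proof -
  have "norm (vartheta2 \<gamma> z)
    \<le> (norm (wave \<gamma> z / (1 + wave \<gamma> z)\<^sup>2) + norm (wave \<gamma> (- z) / (1 + wave \<gamma> (- z))\<^sup>2)) / 2"
    unfolding vartheta2_def norm_mult using norm_triangle_ineq4
    by (simp add: norm_divide[of \<i> 2] del: norm_divide)
  also have "\<dots> \<le> norm \<gamma> * exp b / (1 - norm \<gamma> * exp b)\<^sup>2"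
    by (rule average_le[OF norm_frac_le[OF norm_wave_le[OF assms(2)] assms(1), of 2]
          norm_frac_le[OF norm_wave_neg_le[OF assms(2)] assms(1), of 2]])
  finally show ?thesis .
qed

lemma vartheta_lipschitz:
  assumes "norm \<gamma> * exp b < 1" "w \<in> strip b" "z \<in> strip b"
  shows "norm (vartheta \<gamma> z - vartheta \<gamma> w)
    \<le> norm \<gamma> * exp b / (1 - norm \<gamma> * exp b) * norm (z - w)"
  by (rule field_differentiable_bound[OF convex_strip vartheta_deriv norm_vartheta1_le])
     (use assms in auto)

lemma vartheta_0:
  assumes "norm \<gamma> * exp b < 1" "0 \<le> b"
  shows "vartheta \<gamma> 0 = 0"
  using vartheta_eq_Ln_diff[OF assms(1), of 0] assms(2) by (simp add: strip_def)

lemma vartheta1_0: "vartheta1 \<gamma> 0 = \<i> * \<gamma> / (1 + \<i> * \<gamma>)"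
proof -
  have half: "(x + x) / 2 = x" for x :: complex by simp
  show ?thesis
    by (simp only: vartheta1_def wave_def minus_zero mult_zero_right exp_zero mult_1_right half)
qed

lemma vartheta_linear_approx:
  assumes "norm \<gamma> * exp b < 1" "z \<in> strip b" "0 \<le> b"
  shows "norm (vartheta \<gamma> z - vartheta1 \<gamma> 0 * z)
    \<le> norm \<gamma> * exp b / (1 - norm \<gamma> * exp b)\<^sup>2 * (norm z)\<^sup>2"
proof -
  define f where "f i = (if i = 0 then vartheta \<gamma> else if i = 1 then vartheta1 \<gamma> else vartheta2 \<gamma>)"
    for i :: nat
  have "norm (f 0 z - (\<Sum>i\<le>1. f i 0 * (z - 0) ^ i / fact i))
    \<le> norm \<gamma> * exp b / (1 - norm \<gamma> * exp b)\<^sup>2 * norm (z - 0) ^ Suc 1 / fact 1"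
  proof (rule complex_Taylor[OF convex_strip[of b]])
    fix i :: nat and x
    assume "x \<in> strip b" "i \<le> 1"
    thus "(f i has_field_derivative f (Suc i) x) (at x within strip b)"
      using vartheta_deriv[OF assms(1)] vartheta1_deriv[OF assms(1)]
      by (cases i) (auto simp: f_def)
  next
    fix x assume "x \<in> strip b"
    thus "norm (f (Suc 1) x) \<le> norm \<gamma> * exp b / (1 - norm \<gamma> * exp b)\<^sup>2"
      using norm_vartheta2_le[OF assms(1)] by (simp add: f_def)
  qed (use assms in \<open>auto simp: strip_def\<close>)
  thus ?thesis
    using vartheta_0[OF assms(1,3)] by (simp add: f_def power2_eq_square)
qed

section \<open>Reflection in the point \<open>\<pi> / 2\<close>\<close>

text \<open>
  Since \<open>exp (\<i> \<pi>) = -1\<close>, reflecting the argument exchanges the two exponentials and flips the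
  sign of \<open>\<gamma>\<close>. Exchanging them negates the logarithm of their quotient.
\<close>

lemma vartheta_pi_minus:
  assumes "norm \<gamma> * exp b < 1" "z \<in> strip b"
  shows "vartheta \<gamma> (of_real pi - z) = - vartheta (- \<gamma>) z"
proof -
  have "wave \<gamma> (of_real pi - z) = wave (- \<gamma>) (- z)" "wave \<gamma> (- (of_real pi - z)) = wave (- \<gamma>) z"
    by (simp_all add: wave_def ring_distribs exp_diff exp_minus inverse_eq_divide mult.commute)
  thus ?thesis
    using vartheta_eq_Ln_diff[OF assms(1) pi_minus_mem_strip[OF assms(2)]]
      vartheta_eq_Ln_diff[of "- \<gamma>" b z] assms
    by (simp add: right_diff_distrib diff_divide_distrib)
qed

section \<open>Expansion of the cosine at a small fixed point\<close>

text \<open>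
  The three summands come from the Taylor remainder of \<open>cos\<close>, from the squared Lipschitz constant
  of \<open>vartheta \<gamma>\<close>, and from the bound on its second derivative.
\<close>

definition remainder_const :: "complex \<Rightarrow> real \<Rightarrow> real" where
  "remainder_const \<gamma> b = 6 * exp b
     + (8 * (norm \<gamma> * exp b / (1 - norm \<gamma> * exp b))\<^sup>2
      + 8 * (norm \<gamma> * exp b / (1 - norm \<gamma> * exp b)\<^sup>2))"

text \<open>
  The largeness of \<open>m\<close> gives \<open>norm t \<le> 2 * e\<close>; after that, \<open>1 / m \<le> e\<close> converts the weights
  \<open>1 / m\<close> in the errors into powers of \<open>e\<close>, which makes every error term quartic in \<open>e\<close>.
\<close>

lemma cos_fixed_point_expansion:
  fixes e m :: real and t \<gamma> :: complex
  assumes q: "norm \<gamma> * exp b < 1" and b: "0 \<le> b" and t: "t \<in> strip b"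
    and fp: "t = of_real e + vartheta \<gamma> t / of_real m"
    and m: "0 < m" "2 * (norm \<gamma> * exp b / (1 - norm \<gamma> * exp b)) \<le> m" "1 / m \<le> e"
  shows "norm (2 * cos t - (2 - (of_real e)\<^sup>2 * (1 + 2 * vartheta1 \<gamma> 0 / of_real m)))
    \<le> remainder_const \<gamma> b * e ^ 4"
proof -
  define L K where "L = norm \<gamma> * exp b / (1 - norm \<gamma> * exp b)"
    and "K = norm \<gamma> * exp b / (1 - norm \<gamma> * exp b)\<^sup>2"
  define a where "a = vartheta1 \<gamma> 0"
  have z0: "0 \<in> strip b" using b by (simp add: strip_def)
  have L0: "0 \<le> L" and K0: "0 \<le> K" using q by (auto simp: L_def K_def)
  have e0: "0 < e" using m less_le_trans[of 0 "1/m" e] by simp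
  have th: "norm (vartheta \<gamma> t) \<le> L * norm t"
    using vartheta_lipschitz[OF q z0 t] vartheta_0[OF q b] by (simp add: L_def)
  have a_le: "norm a \<le> L"
    using norm_vartheta1_le[OF q z0] by (simp add: a_def L_def)
  have diff: "t - of_real e = vartheta \<gamma> t / of_real m"
    using fp by (simp add: algebra_simps)
  have d1: "norm (t - of_real e) \<le> L * norm t / m"
    unfolding diff norm_divide using th m(1) by (simp add: divide_right_mono)
  also have "\<dots> \<le> norm t / 2"
    using mult_right_mono[OF m(2), of "norm t"] m(1) by (simp add: L_def[symmetric] field_simps)
  finally have t_le: "norm t \<le> 2 * e"
    using norm_triangle_ineq2[of t "of_real e"] e0 by simp
  have "L * norm t / m = L * norm t * (1 / m)" by simp
  also have "\<dots> \<le> L * (2 * e) * e"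
    using L0 e0 m t_le by (intro mult_mono) auto
  finally have d2: "norm (t - of_real e) \<le> 2 * L * e\<^sup>2"
    using d1 by (simp add: power2_eq_square)
  have d3: "norm (vartheta \<gamma> t - a * t) \<le> 4 * K * e\<^sup>2"
  proof -
    have "norm (vartheta \<gamma> t - a * t) \<le> K * (norm t)\<^sup>2"
      using vartheta_linear_approx[OF q t b] by (simp add: a_def K_def)
    also have "\<dots> \<le> K * (2 * e)\<^sup>2"
      using K0 t_le by (intro mult_left_mono power_mono) auto
    finally show ?thesis by (simp add: power2_eq_square)
  qed
  \<comment> \<open>Expanding \<open>t\<^sup>2\<close> around \<open>e\<close> and substituting the equation for \<open>t - e\<close> isolates two
    pieces, each visibly of order \<open>e ^ 4\<close>.\<close>
  have id: "t\<^sup>2 - (of_real e)\<^sup>2 * (1 + 2 * a / of_real m)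
     = (t - of_real e)\<^sup>2
       + of_real (2 * e * (1 / m)) * ((vartheta \<gamma> t - a * t) + a * (t - of_real e))"
  proof -
    have th_eq: "vartheta \<gamma> t = (t - of_real e) * of_real m" using diff m by simp
    show ?thesis unfolding th_eq using m(1) by (simp add: field_simps power2_eq_square)
  qed
  have sq: "norm (t\<^sup>2 - (of_real e)\<^sup>2 * (1 + 2 * a / of_real m)) \<le> (8 * L\<^sup>2 + 8 * K) * e ^ 4"
  proof -
    have "norm ((t - of_real e)\<^sup>2) \<le> (2 * L * e\<^sup>2)\<^sup>2"
      unfolding norm_power using d2 by (intro power_mono) auto
    moreover have "norm (of_real (2 * e * (1 / m)) * ((vartheta \<gamma> t - a * t) + a * (t - of_real e)))
      \<le> (2 * e * e) * (4 * K * e\<^sup>2 + L * (2 * L * e\<^sup>2))"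
      unfolding norm_mult
    proof (rule mult_mono)
      show "norm (of_real (2 * e * (1 / m)) :: complex) \<le> 2 * e * e"
        unfolding norm_of_real using m(1) e0 mult_left_mono[OF m(3), of "2 * e"] by simp
      have "norm (a * (t - of_real e)) \<le> L * (2 * L * e\<^sup>2)"
        unfolding norm_mult using a_le d2 L0 by (intro mult_mono) auto
      thus "norm ((vartheta \<gamma> t - a * t) + a * (t - of_real e)) \<le> 4 * K * e\<^sup>2 + L * (2 * L * e\<^sup>2)"
        using d3 norm_triangle_ineq[of "vartheta \<gamma> t - a * t" "a * (t - of_real e)"] by linarith
    qed (use e0 in auto)
    moreover have "(2 * L * e\<^sup>2)\<^sup>2 + (2 * e * e) * (4 * K * e\<^sup>2 + L * (2 * L * e\<^sup>2))
       = (8 * L\<^sup>2 + 8 * K) * e ^ 4"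
      by (simp add: power2_eq_square power4_eq_xxxx algebra_simps)
    ultimately show ?thesis
      unfolding id using norm_triangle_ineq order_trans
      by (smt (verit, best))
  qed
  have cs: "norm (2 * cos t - (2 - t\<^sup>2)) \<le> 6 * exp b * e ^ 4"
  proof -
    have "(\<Sum>k\<le>3. of_real (cos_coeff k) * t ^ k) = 1 - t\<^sup>2 / 2"
      by (simp add: numeral_3_eq_3 power2_eq_square cos_coeff_def)
    hence "norm (cos t - (1 - t\<^sup>2 / 2)) \<le> exp \<bar>Im t\<bar> * norm t ^ 4 / 6"
      using Taylor_cos[of t 3] by (simp add: fact_numeral)
    also have "\<dots> \<le> exp b * (2 * e) ^ 4 / 6"
      using t t_le by (intro divide_right_mono mult_mono power_mono) (auto simp: strip_def)
    also have "\<dots> \<le> 3 * exp b * e ^ 4"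
      by (simp add: power_mult_distrib)
    finally have "norm (cos t - (1 - t\<^sup>2 / 2)) \<le> 3 * exp b * e ^ 4" .
    moreover have "2 * cos t - (2 - t\<^sup>2) = 2 * (cos t - (1 - t\<^sup>2 / 2))" by (simp add: algebra_simps)
    ultimately show ?thesis by (simp only: norm_mult) simp
  qed
  have "2 * cos t - (2 - (of_real e)\<^sup>2 * (1 + 2 * a / of_real m))
     = (2 * cos t - (2 - t\<^sup>2)) - (t\<^sup>2 - (of_real e)\<^sup>2 * (1 + 2 * a / of_real m))"
    by (simp add: algebra_simps)
  hence "norm (2 * cos t - (2 - (of_real e)\<^sup>2 * (1 + 2 * a / of_real m)))
     \<le> 6 * exp b * e ^ 4 + (8 * L\<^sup>2 + 8 * K) * e ^ 4"
    using norm_triangle_ineq4[of "2 * cos t - (2 - t\<^sup>2)" "t\<^sup>2 - (of_real e)\<^sup>2 * (1 + 2 * a / of_real m)"]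
      cs sq by (smt (verit))
  thus ?thesis
    by (simp add: a_def remainder_const_def L_def K_def ring_distribs)
qed

section \<open>Existence and location of the fixed point\<close>

text \<open>
  Banach's theorem needs a complete domain and hence the closed ball. As the map sends the closed
  ball into the open one, no fixed point lies on the boundary, and uniqueness passes to the
  open ball.
\<close>

lemma contraction_fixed_point_ex1:
  fixes g :: "complex \<Rightarrow> complex"
  assumes k: "0 \<le> k" "k < 1" and R: "0 < R"
    and lip: "\<And>x y. x \<in> cball p R \<Longrightarrow> y \<in> cball p R \<Longrightarrow> dist (g x) (g y) \<le> k * dist x y"
    and into: "\<And>x. x \<in> cball p R \<Longrightarrow> dist p (g x) < R"
  shows "\<exists>!s. s \<in> ball p R \<and> s = g s"
proof -
  have ex: "\<exists>!x. x \<in> cball p R \<and> g x = x"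
  proof (rule Banach_fix)
    show "complete (cball p R)" by (simp add: complete_eq_closed)
    show "g ` cball p R \<subseteq> cball p R" using into by (force intro: less_imp_le)
  qed (use k R lip in auto)
  have "x \<in> ball p R \<and> x = g x \<longleftrightarrow> x \<in> cball p R \<and> g x = x" for x
    using into[of x] by auto
  thus ?thesis using ex by simp
qed

text \<open>
  Half of the half-width \<open>ln (1 / norm \<gamma>)\<close> of the natural strip. In this smaller strip, the
  exponential terms in \<open>vartheta\<close> are bounded by \<open>sqrt (norm \<gamma>)\<close>, which is below \<open>1\<close> when
  \<open>norm \<gamma> < 1\<close>.
\<close>

definition half_width :: "complex \<Rightarrow> real" where
  "half_width \<gamma> = - ln (norm \<gamma>) / 2"

lemma norm_times_exp_half_width:
  assumes "0 < norm \<gamma>"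
  shows "norm \<gamma> * exp (half_width \<gamma>) = sqrt (norm \<gamma>)"
proof -
  have "exp (half_width \<gamma>) ^ 2 = inverse (norm \<gamma>)"
    unfolding exp_double[symmetric] using assms by (simp add: half_width_def exp_minus)
  hence "(norm \<gamma> * exp (half_width \<gamma>))\<^sup>2 = norm \<gamma>"
    using assms unfolding power_mult_distrib by (simp add: power2_eq_square)
  thus ?thesis
    by (intro real_sqrt_unique[symmetric]) auto
qed

lemma half_width_ge:
  assumes "0 < norm \<gamma>"
  shows "(1 - norm \<gamma>) / 2 \<le> half_width \<gamma>"
  using ln_le_minus_one[OF assms] by (simp add: half_width_def)

lemma sqrt_over_one_minus_sqrt_le:
  assumes "0 < r" "r < 1"
  shows "sqrt r / (1 - sqrt r) \<le> 2 * sqrt r / (1 - r)"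
proof -
  define q where "q = sqrt r"
  have q: "0 < q" "q < 1" "r = q * q" using assms by (auto simp: q_def)
  have "1 - r = (1 - q) * (1 + q)" unfolding q(3) by (simp add: algebra_simps)
  hence "2 * q / (1 - r) = q / (1 - q) * (2 / (1 + q))" by simp
  moreover have "q / (1 - q) * 1 \<le> q / (1 - q) * (2 / (1 + q))"
    using q(1,2) by (intro mult_left_mono) auto
  ultimately show ?thesis unfolding q_def[symmetric] by simp
qed

text \<open>
  With \<open>r = norm \<gamma>\<close> and \<open>q = sqrt r\<close>, the constants \<open>M_const\<close> and \<open>N_const\<close> are balanced
  so that three things hold: the disk stays in the strip of half-width \<open>(1 - r) / 2\<close>, the map
  \<open>z \<mapsto> d + vartheta \<gamma> z / m\<close> contracts it by the factor \<open>1 / 8\<close>, and the centre, which is the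
  image of \<open>d\<close> under this map, is moved by less than half the radius. The estimate of \<open>vartheta\<close> at the real point
  \<open>d\<close> uses the strip of width \<open>0\<close>: the Lipschitz constant \<open>r / (1 - r)\<close> available there is
  smaller than the one in the wider strip, which would be too weak to place the disk inside that
  strip when \<open>r\<close> is close to \<open>1\<close>.
\<close>

lemma s_pt_fixed_point:
  assumes r: "0 < norm \<gamma>" "norm \<gamma> < 1" and n: "N_const \<gamma> \<le> real n" and j: "j \<in> {1..n}"
  shows "s_pt \<gamma> n j \<in> strip (half_width \<gamma>)"
    and "s_pt \<gamma> n j = of_real (d_pt n j) + vartheta \<gamma> (s_pt \<gamma> n j) / of_real (real n + 1)"
    and "2 * (norm \<gamma> * exp (half_width \<gamma>) / (1 - norm \<gamma> * exp (half_width \<gamma>))) \<le> real n + 1"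
proof -
  define r q m b d p where "r = norm \<gamma>" and "q = sqrt r" and "m = real n + 1"
    and "b = half_width \<gamma>" and "d = d_pt n j" and "p = p_pt \<gamma> n j"
  define R where "R = M_const \<gamma> / m\<^sup>2"
  define L where "L = q / (1 - q)"
  have r01: "0 < r" "r < 1" and q: "0 < q" "q < 1"
    using r by (auto simp: r_def q_def)
  have qe: "norm \<gamma> * exp b = q"
    using norm_times_exp_half_width[OF r(1)] by (simp add: b_def q_def r_def)
  have q1: "norm \<gamma> * exp b < 1" using qe q by simp
  have m: "16 / (1 - r)\<^sup>2 < m" and m0: "0 < m"
    using n by (auto simp: N_const_def m_def r_def)
  have im: "1 / m \<le> (1 - r)\<^sup>2 / 16"
    using le_imp_inverse_le[OF less_imp_le[OF m]] r01 by (simp add: inverse_eq_divide)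
  have M: "M_const \<gamma> = 64 * q / (1 - r) ^ 3" by (simp add: M_const_def r_def q_def)
  have R0: "0 < R" using q r01 m0 by (simp add: R_def M)
  have L2: "L \<le> 2 * q / (1 - r)" and L0: "0 \<le> L"
    using sqrt_over_one_minus_sqrt_le[OF r01] q by (simp_all add: L_def flip: q_def)
  have "L / m \<le> 2 * q / (1 - r) * ((1 - r)\<^sup>2 / 16)"
    using mult_mono[OF L2 im] q r01 m0 by simp
  also have "\<dots> = q * (1 - r) / 8"
    using r01 by (simp add: power2_eq_square)
  also have "\<dots> \<le> 1 * 1 / 8"
    using q r01 by (intro divide_right_mono mult_mono) auto
  finally have Lm: "L / m \<le> 1 / 8" by simp
  hence L8: "8 * L \<le> m" using m0 by (simp add: field_simps)
  show "2 * (norm \<gamma> * exp (half_width \<gamma>) / (1 - norm \<gamma> * exp (half_width \<gamma>))) \<le> real n + 1"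
    unfolding b_def[symmetric] qe L_def[symmetric] m_def[symmetric] using L8 L0 by linarith
  have "real j * pi \<le> (real n + 1) * pi"
    using j by (intro mult_right_mono) auto
  hence d: "0 \<le> d" "d \<le> pi"
    by (simp_all add: d_def d_pt_def field_simps)
  have th_d: "norm (vartheta \<gamma> (of_real d)) \<le> pi * r / (1 - r)"
  proof -
    have "norm (vartheta \<gamma> (of_real d)) \<le> r / (1 - r) * d"
      using vartheta_lipschitz[of \<gamma> 0 0 "of_real d"] vartheta_0[of \<gamma> 0] r d
      by (simp add: strip_def r_def)
    also have "\<dots> \<le> r / (1 - r) * pi"
      using d r01 by (intro mult_left_mono) auto
    finally show ?thesis by (simp add: mult.commute)
  qed
  have p_eq: "p = of_real d + vartheta \<gamma> (of_real d) / of_real m"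
    by (simp add: p_def p_pt_def d_def m_def)
  have pd: "norm (p - of_real d) \<le> pi * r / (1 - r) * (1 / m)"
    using divide_right_mono[OF th_d less_imp_le[OF m0]] m0 unfolding p_eq by (simp add: norm_divide)
  have b_ge: "(1 - r) / 2 \<le> b" using half_width_ge[OF r(1)] by (simp add: b_def r_def)
  hence d_strip: "of_real d \<in> strip b" using r01 by (simp add: strip_def)
  have sub: "z \<in> strip b" if "z \<in> cball p R" for z
  proof -
    have "\<bar>Im z\<bar> \<le> norm (z - p) + norm (p - of_real d)"
      using abs_Im_le_cmod[of "z - p"] abs_Im_le_cmod[of "p - of_real d"] by simp
    also have "\<dots> \<le> R + pi * r / (1 - r) * (1 / m)"
      using that pd by (simp add: dist_norm norm_minus_commute)
    also have "\<dots> \<le> 64 * q / (1 - r) ^ 3 * ((1 - r)\<^sup>2 / 16)\<^sup>2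
        + pi * r / (1 - r) * ((1 - r)\<^sup>2 / 16)"
    proof (intro add_mono mult_left_mono im)
      have "(1 / m)\<^sup>2 \<le> ((1 - r)\<^sup>2 / 16)\<^sup>2" using im m0 by (intro power_mono) auto
      hence "64 * q / (1 - r) ^ 3 * (1 / m)\<^sup>2 \<le> 64 * q / (1 - r) ^ 3 * ((1 - r)\<^sup>2 / 16)\<^sup>2"
        using q r01 by (intro mult_left_mono) auto
      thus "R \<le> 64 * q / (1 - r) ^ 3 * ((1 - r)\<^sup>2 / 16)\<^sup>2"
        by (simp add: R_def M power_divide)
    qed (use r01 in auto)
    also have "\<dots> = (q / 4 + pi * r / 16) * (1 - r)"
    proof -
      define c where "c = 1 - r"
      have "c \<noteq> 0" using r01 by (simp add: c_def)
      thus ?thesis unfolding c_def[symmetric] by (simp add: field_simps power2_eq_square power3_eq_cube)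
    qed
    also have "\<dots> \<le> (1 / 2) * (1 - r)"
    proof (rule mult_right_mono)
      have "pi * r \<le> 4 * 1" using r01 pi_less_4 by (intro mult_mono) auto
      thus "q / 4 + pi * r / 16 \<le> 1 / 2" using q by simp
    qed (use r01 in simp)
    finally show ?thesis using b_ge by (simp add: strip_def)
  qed
  define g where "g z = of_real d + vartheta \<gamma> z / of_real m" for z
  have g_lip: "norm (g x - g y) \<le> L / m * norm (x - y)" if "x \<in> strip b" "y \<in> strip b" for x y
  proof -
    have "g x - g y = (vartheta \<gamma> x - vartheta \<gamma> y) / of_real m"
      by (simp add: g_def diff_divide_distrib)
    thus ?thesis
      using divide_right_mono[OF vartheta_lipschitz[OF q1 that(2,1)] less_imp_le[OF m0]] m0
      by (simp add: norm_divide qe L_def)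
  qed
  have ex1: "\<exists>!s. s \<in> ball p R \<and> s = g s"
  proof (rule contraction_fixed_point_ex1)
    show "0 \<le> L / m" "L / m < 1" "0 < R" using L0 m0 Lm R0 by auto
    show "dist (g x) (g y) \<le> L / m * dist x y" if "x \<in> cball p R" "y \<in> cball p R" for x y
      using g_lip sub that by (simp add: dist_norm)
    show "dist p (g x) < R" if x: "x \<in> cball p R" for x
    proof -
      have "dist p (g x) = norm (g x - g (of_real d))"
        by (simp add: p_eq g_def dist_norm norm_minus_commute)
      also have "\<dots> \<le> L / m * norm (x - of_real d)"
        by (rule g_lip[OF sub[OF x] d_strip])
      also have "\<dots> \<le> L / m * (R + pi * r / (1 - r) * (1 / m))"
      proof (rule mult_left_mono)
        show "norm (x - of_real d) \<le> R + pi * r / (1 - r) * (1 / m)"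
          using x pd norm_triangle_ineq[of "x - p" "p - of_real d"]
          by (simp add: dist_norm norm_minus_commute)
      qed (use L0 m0 in simp)
      also have "\<dots> = L / m * R + L * (pi * r / (1 - r)) / m\<^sup>2"
        by (simp add: distrib_left power2_eq_square mult_ac)
      also have "\<dots> < R / 2 + R / 2"
      proof (rule add_le_less_mono)
        have "L / m * R \<le> 1 / 8 * R" using R0 by (intro mult_right_mono Lm) simp
        also have "\<dots> \<le> R / 2" using R0 by simp
        finally show "L / m * R \<le> R / 2" .
        have "pi * r < 16" using mult_strict_mono[of pi 4 r 1] r01 pi_less_4 by simp
        have "L * (pi * r / (1 - r)) \<le> 2 * q / (1 - r) * (pi * r / (1 - r))"
          using L2 r01 by (intro mult_right_mono) auto
        also have "\<dots> = 2 * q * (pi * r) * (1 - r) / (1 - r) ^ 3"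
          using r01 by (simp add: power3_eq_cube)
        also have "\<dots> < 32 * q / (1 - r) ^ 3"
        proof (rule divide_strict_right_mono)
          have "q * (pi * r) * (1 - r) \<le> q * (pi * r) * 1"
            using q r01 by (intro mult_left_mono) auto
          also have "\<dots> < q * 16" using \<open>pi * r < 16\<close> q by simp
          finally have "2 * (q * (pi * r) * (1 - r)) < 2 * (q * 16)"
            by (rule mult_strict_left_mono) simp
          thus "2 * q * (pi * r) * (1 - r) < 32 * q" by (simp add: mult.assoc)
        qed (use r01 in simp)
        finally have "L * (pi * r / (1 - r)) / m\<^sup>2 < 32 * q / (1 - r) ^ 3 / m\<^sup>2"
          using m0 by (intro divide_strict_right_mono) auto
        thus "L * (pi * r / (1 - r)) / m\<^sup>2 < R / 2" by (simp add: R_def M mult.commute)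
      qed
      finally show ?thesis by simp
    qed
  qed
  have s_eq: "s_pt \<gamma> n j = (THE s. s \<in> ball p R \<and> s = g s)"
    by (simp add: s_pt_def B_disk_def p_def R_def m_def g_def d_def d_pt_def)
  have s: "s_pt \<gamma> n j \<in> ball p R" "s_pt \<gamma> n j = g (s_pt \<gamma> n j)"
    using theI'[OF ex1] unfolding s_eq by auto
  show "s_pt \<gamma> n j \<in> strip (half_width \<gamma>)"
    using s(1) sub unfolding b_def[symmetric] by auto
  show "s_pt \<gamma> n j = of_real (d_pt n j) + vartheta \<gamma> (s_pt \<gamma> n j) / of_real (real n + 1)"
    using s(2) unfolding g_def d_def m_def .
qed

section \<open>The two asymptotic formulas\<close>

theorem theorem5:
  fixes \<gamma> :: complex
  assumes "0 < norm \<gamma>" and "norm \<gamma> < 1"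
  shows "expansion_near (N_const \<gamma>) 0 (lam \<gamma>)
           (\<lambda>n j. 2 * \<i>
              - \<i> * (of_real pi)\<^sup>2 * (of_nat j)\<^sup>2 / (of_nat n + 1)\<^sup>2
              + 2 * \<gamma> / (1 + \<i> * \<gamma>) * ((of_real pi)\<^sup>2 * (of_nat j)\<^sup>2 / (of_nat n + 1) ^ 3))
           (\<lambda>n j. real j ^ 4 / real n ^ 4)
       \<and> expansion_near (N_const \<gamma>) 1 (lam \<gamma>)
           (\<lambda>n j. - 2 * \<i>
              + \<i> * (of_real pi)\<^sup>2 * (1 - of_nat j / (of_nat n + 1))\<^sup>2
              + 2 * \<gamma> * (of_real pi)\<^sup>2 / (1 - \<i> * \<gamma>)
                  * ((1 - of_nat j / (of_nat n + 1))\<^sup>2 / (of_nat n + 1)))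
           (\<lambda>n j. (1 - real j / (real n + 1)) ^ 4)"
proof -
  define b C where "b = half_width \<gamma>" and "C = remainder_const \<gamma> b"
  have b0: "0 \<le> b" using half_width_ge[OF assms(1)] assms(2) by (simp add: b_def)
  have q1: "norm \<gamma> * exp b < 1"
    using norm_times_exp_half_width[OF assms(1)] assms(2) by (simp add: b_def)
  have C0: "0 < C"
    unfolding C_def remainder_const_def using q1 by (intro add_pos_nonneg) auto
  have double_rotation: "\<i> * (2 * (\<i> * w)) = - (2 * w)" for w :: complex
    by (simp add: complex_eq_iff)
  have left: "norm (lam \<gamma> n j - (2 * \<i>
              - \<i> * (of_real pi)\<^sup>2 * (of_nat j)\<^sup>2 / (of_nat n + 1)\<^sup>2
              + 2 * \<gamma> / (1 + \<i> * \<gamma>) * ((of_real pi)\<^sup>2 * (of_nat j)\<^sup>2 / (of_nat n + 1) ^ 3)))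
      \<le> C * pi ^ 4 * (real j ^ 4 / real n ^ 4)" (is "norm (_ - ?Y) \<le> _")
    if nj: "N_const \<gamma> \<le> real n" "j \<in> {1..n}" for n j
  proof -
    define s e m where "s = s_pt \<gamma> n j" and "e = d_pt n j" and "m = real n + 1"
    have m0: "0 < m" by (simp add: m_def)
    have e_eq: "e = real j * pi / m" by (simp add: e_def d_pt_def m_def)
    note sp = s_pt_fixed_point[OF assms nj, folded b_def s_def e_def m_def]
    have "1 * 1 \<le> real j * pi" using nj pi_ge_two by (intro mult_mono) auto
    hence e1: "1 / m \<le> e" unfolding e_eq using m0 by (intro divide_right_mono) auto
    define E where "E = 2 * cos s - (2 - (of_real e)\<^sup>2 * (1 + 2 * vartheta1 \<gamma> 0 / of_real m))"
    have E: "norm E \<le> C * e ^ 4"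
      unfolding E_def C_def
      by (rule cos_fixed_point_expansion[OF q1 b0 sp(1,2) m0 sp(3) e1])
    have coeff: "- \<i> * (2 * vartheta1 \<gamma> 0) = 2 * \<gamma> / (1 + \<i> * \<gamma>)"
      unfolding vartheta1_0 by (simp add: double_rotation)
    have ec: "(of_real e)\<^sup>2 = (of_real pi)\<^sup>2 * (of_nat j)\<^sup>2 / (of_real m :: complex)\<^sup>2"
      by (simp add: e_eq power_divide power_mult_distrib)
    have mc: "of_nat n + 1 = (of_real m :: complex)" by (simp add: m_def)
    have "?Y = 2 * \<i> - \<i> * (of_real e)\<^sup>2
        + (- \<i> * (2 * vartheta1 \<gamma> 0)) * ((of_real e)\<^sup>2 / of_real m)"
      unfolding mc coeff ec by (simp add: power2_eq_square power3_eq_cube mult.assoc)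
    moreover have "lam \<gamma> n j = \<i> * (2 * cos s)" by (simp add: lam_def psi_def s_def)
    ultimately have "lam \<gamma> n j - ?Y = \<i> * E"
      by (simp add: E_def algebra_simps)
    hence "norm (lam \<gamma> n j - ?Y) \<le> C * e ^ 4" using E by (simp add: norm_mult)
    also have "\<dots> \<le> C * (pi * (real j / real n)) ^ 4"
    proof (intro mult_left_mono power_mono)
      have "real j / m \<le> real j / real n" using nj m0 by (intro divide_left_mono) (auto simp: m_def)
      thus "e \<le> pi * (real j / real n)"
        using mult_left_mono[of "real j / m" "real j / real n" pi] by (simp add: e_eq mult.commute)
      show "0 \<le> e" using e_eq m0 by simp
    qed (use C0 in auto)
    finally show ?thesis by (simp add: power_mult_distrib power_divide)
  qed
  have right: "norm (lam \<gamma> n j - (- 2 * \<i>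
              + \<i> * (of_real pi)\<^sup>2 * (1 - of_nat j / (of_nat n + 1))\<^sup>2
              + 2 * \<gamma> * (of_real pi)\<^sup>2 / (1 - \<i> * \<gamma>)
                  * ((1 - of_nat j / (of_nat n + 1))\<^sup>2 / (of_nat n + 1))))
      \<le> C * pi ^ 4 * (1 - real j / (real n + 1)) ^ 4" (is "norm (_ - ?Y) \<le> _")
    if nj: "N_const \<gamma> \<le> real n" "j \<in> {1..n}" for n j
  proof -
    define s m where "s = s_pt \<gamma> n j" and "m = real n + 1"
    define e t where "e = pi * (1 - real j / m)" and "t = of_real pi - s"
    have m0: "0 < m" by (simp add: m_def)
    have de: "d_pt n j = pi - e" by (simp add: e_def d_pt_def m_def algebra_simps)
    note sp = s_pt_fixed_point[OF assms nj, folded b_def s_def m_def]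
    have t: "t \<in> strip b" unfolding t_def by (rule pi_minus_mem_strip[OF sp(1)])
    have "vartheta \<gamma> s = - vartheta (- \<gamma>) t"
      using vartheta_pi_minus[OF q1 t] by (simp add: t_def)
    hence fp: "t = of_real e + vartheta (- \<gamma>) t / of_real m"
      using sp(2) unfolding de by (simp add: t_def algebra_simps)
    have "1 * 1 \<le> pi * (m - real j)" using nj pi_ge_two by (intro mult_mono) (auto simp: m_def)
    hence e1: "1 / m \<le> e" unfolding e_def using m0 by (simp add: field_simps)
    define E where "E = 2 * cos t - (2 - (of_real e)\<^sup>2 * (1 + 2 * vartheta1 (- \<gamma>) 0 / of_real m))"
    have E: "norm E \<le> C * e ^ 4"
      unfolding E_def C_def
      using cos_fixed_point_expansion[of "- \<gamma>" b t e m, OF _ b0 t fp m0 _ e1] q1 sp(3)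
      by (simp add: remainder_const_def)
    have coeff: "\<i> * (2 * vartheta1 (- \<gamma>) 0) = 2 * \<gamma> / (1 - \<i> * \<gamma>)"
      unfolding vartheta1_0 by (simp add: double_rotation)
    have ec: "(of_real e)\<^sup>2 = (of_real pi)\<^sup>2 * (1 - of_nat j / (of_real m :: complex))\<^sup>2"
      by (simp add: e_def power_mult_distrib)
    have mc: "of_nat n + 1 = (of_real m :: complex)" by (simp add: m_def)
    have "?Y = - 2 * \<i> + \<i> * (of_real e)\<^sup>2
        + (\<i> * (2 * vartheta1 (- \<gamma>) 0)) * ((of_real e)\<^sup>2 / of_real m)"
      unfolding mc coeff ec by (simp add: mult_ac)
    moreover have "lam \<gamma> n j = - \<i> * (2 * cos t)"
      by (simp add: lam_def psi_def s_def t_def cos_diff)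
    ultimately have "lam \<gamma> n j - ?Y = - \<i> * E"
      by (simp add: E_def algebra_simps)
    hence "norm (lam \<gamma> n j - ?Y) \<le> C * e ^ 4" using E by (simp add: norm_mult)
    thus ?thesis by (simp add: e_def m_def power_mult_distrib mult_ac)
  qed
  \<comment> \<open>The bounds are uniform in \<open>1 \<le> j \<le> n\<close>, so \<open>1\<close> serves as the radius \<open>\<epsilon>\<close>.\<close>
  have "0 < C * pi ^ 4" using C0 by simp
  thus ?thesis
    unfolding expansion_near_def using left right
    by (intro conjI exI[of _ "C * pi ^ 4"] exI[of _ "1 :: real"]) auto
qed

end
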